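(* Let $i,j\ge 0$ be integers. Then $M(c^i,c^j)$ is half of the total weight of all Delannoy paths from $(-1,0)$ or $(0,-1)$ to $(i,j)$, where each East step and each North step has weight $c$ and each Northeast step has weight $2d-c^2$. The weight of a Delannoy path is the (noncommutative) product of the weights of its steps, taken left to right in the order from $(-1,0)$ or $(0,-1)$ to $(i,j)$.
   Context: A Delannoy path is a lattice path consisting of East steps $(1,0)$, North steps $(0,1)$ and Northeast steps $(1,1)$. In the free associative algebra $\mathbb{Q}\langle a,b\rangle$ on noncommuting variables $a,b$ (with basis all $ab$-words, including the empty word $1$) put $c=a+b$ and $d=ab+ba$. The coproduct $\Delta$ is the linear map with $\Delta(u)=\sum_{i=1}^n u_1\cdots u_{i-1}\otimes u_{i+1}\cdots u_n$ for an $ab$-word $u=u_1\cdots u_n$ (so $\Delta(1)=0$), written in Sweedler notation as $\Delta(u)=\sum_u u_{(1)}\otimes u_{(2)}$. The mixing operator $M$ is the bilinear operator on $\mathbb{Q}\langle a,b\rangle$ given by $$M(u,v)=\sum_{r=1}^2\sum_{s=1}^2\ \sum_{n\ge 2,\ n-r-s-1\text{ even}}M_{r,s,n}(u,v),$$ where the bilinear operators $M_{r,s,n}$ (needed only for $n-r-s-1$ even) are defined recursively by $M_{1,2,2}(u,v)=u\cdot a\cdot v$, $M_{2,1,2}(u,v)=v\cdot b\cdot u$, and for $n\ge 2$: $M_{1,s,n+1}(u,v)=\sum_u u_{(1)}\cdot a\cdot M_{2,s,n}(u_{(2)},v)$ and $M_{2,s,n+1}(u,v)=\sum_v v_{(1)}\cdot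 b\cdot M_{1,s,n}(u,v_{(2)})$. For given $u,v$ only finitely many terms are nonzero. *)

theory Defs
  imports Complex_Main "HOL-Library.Poly_Mapping" "HOL-Library.Product_Plus"
begin

section \<open>The free associative algebra on two noncommuting variables\<close>

datatype letter = A | B

datatype word = Word (letters: "letter list")

text \<open>
  Words form a monoid under concatenation. It is written additively, since the
  product of finitely supported functions in \<^theory>\<open>HOL-Library.Poly_Mapping\<close> is the
  convolution product over an additive (not necessarily commutative) monoid.
\<close>

instantiation word :: monoid_add
begin

definition zero_word :: word where
  "0 = Word []"

definition plus_word :: "word \<Rightarrow> word \<Rightarrow> word" where
  "w + w' = Word (letters w @ letters w')"

instance
  by standard (simp_all add: zero_word_def plus_word_def)

end

type_synonym alg = "word \<Rightarrow>\<^sub>0 rat"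

definition of_word :: "word \<Rightarrow> alg" where
  "of_word w = Poly_Mapping.single w 1"

definition of_scalar :: "rat \<Rightarrow> alg" where
  "of_scalar q = Poly_Mapping.single 0 q"

definition var_a :: alg where "var_a = of_word (Word [A])"
definition var_b :: alg where "var_b = of_word (Word [B])"
definition elt_c :: alg where "elt_c = var_a + var_b"
definition elt_d :: alg where "elt_d = var_a * var_b + var_b * var_a"

lemma of_word_times: "of_word w * of_word w' = of_word (w + w')"
  by (simp add: of_word_def mult_single)

lemma lookup_of_scalar_times:
  "Poly_Mapping.lookup (of_scalar q * x) w = q * Poly_Mapping.lookup x w"
proof (induction x rule: update_induct)
  case const
  show ?case by simp
next
  case (update f k v)
  have "Poly_Mapping.update k v f = f + Poly_Mapping.single k v"
    using update(1)
    by (intro poly_mapping_eqI)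
      (auto simp: lookup_update lookup_add lookup_single when_def in_keys_iff)
  with update(3) show ?case
    by (simp add: distrib_left lookup_add of_scalar_def mult_single lookup_single when_def)
qed

section \<open>The coproduct\<close>

text \<open>The tensor square of the algebra, with basis the pairs of words.\<close>

type_synonym alg2 = "(word \<times> word) \<Rightarrow>\<^sub>0 rat"

definition coproduct_word :: "word \<Rightarrow> alg2" where
  "coproduct_word w =
     (\<Sum>i<length (letters w).
        Poly_Mapping.single (Word (take i (letters w)), Word (drop (Suc i) (letters w))) 1)"

definition coproduct :: "alg \<Rightarrow> alg2" where
  "coproduct u =
     (\<Sum>w\<in>Poly_Mapping.keys u.
        Poly_Mapping.map ((*) (Poly_Mapping.lookup u w)) (coproduct_word w))"

text \<open>
  For a bilinear \<open>f\<close>, this is the value at \<open>t\<close> of the linear map induced by \<open>f\<close> on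
  the tensor square. At \<open>t = coproduct u\<close> it is the Sweedler sum of
  \<open>f u\<^sub>1 u\<^sub>2\<close>.
\<close>

definition sweedler :: "(alg \<Rightarrow> alg \<Rightarrow> alg) \<Rightarrow> alg2 \<Rightarrow> alg" where
  "sweedler f t =
     (\<Sum>(w, w')\<in>Poly_Mapping.keys t.
        of_scalar (Poly_Mapping.lookup t (w, w')) * f (of_word w) (of_word w'))"

section \<open>The mixing operator\<close>

text \<open>
  Only \<open>r, s \<in> {1, 2}\<close>, \<open>n \<ge> 2\<close> and \<open>n - r - s - 1\<close> even matter; the operators
  for other indices (such as \<open>r = s\<close>, \<open>n = 2\<close>) get junk values and are never used, because the
  recursion preserves these conditions.
\<close>

fun mixing_rsn :: "nat \<Rightarrow> nat \<Rightarrow> nat \<Rightarrow> alg \<Rightarrow> alg \<Rightarrow> alg" where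
  "mixing_rsn r s n u v =
     (if n < 2 then 0
      else if n = 2 then
        (if r = 1 \<and> s = 2 then u * var_a * v
         else if r = 2 \<and> s = 1 then v * var_b * u
         else 0)
      else if r = 1 then
        sweedler (\<lambda>u1 u2. u1 * var_a * mixing_rsn 2 s (n - 1) u2 v) (coproduct u)
      else if r = 2 then
        sweedler (\<lambda>v1 v2. v1 * var_b * mixing_rsn 1 s (n - 1) u v2) (coproduct v)
      else 0)"

declare mixing_rsn.simps [simp del]

lemma mixing_rsn_base:
  "mixing_rsn 1 2 2 u v = u * var_a * v"
  "mixing_rsn 2 1 2 u v = v * var_b * u"
  by (simp_all add: mixing_rsn.simps)

lemma mixing_rsn_step:
  assumes "n \<ge> 2"
  shows "mixing_rsn 1 s (n + 1) u v =
           sweedler (\<lambda>u1 u2. u1 * var_a * mixing_rsn 2 s n u2 v) (coproduct u)"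
    and "mixing_rsn 2 s (n + 1) u v =
           sweedler (\<lambda>v1 v2. v1 * var_b * mixing_rsn 1 s n u v2) (coproduct v)"
  using assms by (subst mixing_rsn.simps, simp)+

text \<open>
  The sum over all \<open>n \<ge> 2\<close> of the right parity is restricted to its nonzero terms, of
  which there are finitely many (see \<open>finite_mixing_support\<close> below).
\<close>

definition mixing_support :: "nat \<Rightarrow> nat \<Rightarrow> alg \<Rightarrow> alg \<Rightarrow> nat set" where
  "mixing_support r s u v =
     {n. n \<ge> 2 \<and> even (int n - int r - int s - 1) \<and> mixing_rsn r s n u v \<noteq> 0}"

definition mixing :: "alg \<Rightarrow> alg \<Rightarrow> alg" where
  "mixing u v = (\<Sum>r\<in>{1,2}. \<Sum>s\<in>{1,2}. \<Sum>n\<in>mixing_support r s u v. mixing_rsn r s n u v)"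

lemma keys_sum_subset:
  "Poly_Mapping.keys (\<Sum>x\<in>X. f x) \<subseteq> (\<Union>x\<in>X. Poly_Mapping.keys (f x))"
proof (induction X rule: infinite_finite_induct)
  case (insert x X)
  then show ?case using Poly_Mapping.keys_add[of "f x" "\<Sum>x\<in>X. f x"] by auto
qed auto

lemma keys_coproduct:
  assumes "(w1, w2) \<in> Poly_Mapping.keys (coproduct u)"
  shows "\<exists>w\<in>Poly_Mapping.keys u. length (letters w) = length (letters w1) + length (letters w2) + 1"
proof -
  from subsetD[OF keys_sum_subset assms[unfolded coproduct_def]]
  obtain w where w: "w \<in> Poly_Mapping.keys u"
    and *: "(w1, w2) \<in> Poly_Mapping.keys
              (Poly_Mapping.map ((*) (Poly_Mapping.lookup u w)) (coproduct_word w))"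
    by blast
  have **: "(w1, w2) \<in> Poly_Mapping.keys (coproduct_word w)"
    using * by (auto simp: in_keys_iff map.rep_eq when_def split: if_splits)
  from subsetD[OF keys_sum_subset **[unfolded coproduct_word_def]]
  obtain i where i: "i < length (letters w)"
    and "(w1, w2) \<in> Poly_Mapping.keys (Poly_Mapping.single
           (Word (take i (letters w)), Word (drop (Suc i) (letters w))) (1::rat))"
    by blast
  then have "w1 = Word (take i (letters w))" "w2 = Word (drop (Suc i) (letters w))"
    by (auto split: if_splits)
  with i w show ?thesis by (intro bexI[of _ w]) auto
qed

lemma mixing_rsn_eq_0:
  assumes "\<And>w. w \<in> Poly_Mapping.keys u \<Longrightarrow> length (letters w) \<le> p"
    and "\<And>w. w \<in> Poly_Mapping.keys v \<Longrightarrow> length (letters w) \<le> q"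
    and "n > p + q + 2"
  shows "mixing_rsn r s n u v = 0"
  using assms
proof (induction n arbitrary: r u v p q rule: less_induct)
  case (less n)
  have n: "\<not> n < 2" "n \<noteq> 2" using less.prems(3) by auto
  have 1: "mixing_rsn 2 s (n - 1) (of_word w2) v = 0"
    if "(w1, w2) \<in> Poly_Mapping.keys (coproduct u)" for w1 w2
  proof -
    have "length (letters w2) + 1 \<le> p"
      using keys_coproduct[OF that] less.prems(1) by fastforce
    then show ?thesis
      using less.prems(2,3) by (intro less.IH[where p = "p - 1" and q = q])
        (auto simp: of_word_def split: if_splits)
  qed
  have 2: "mixing_rsn 1 s (n - 1) u (of_word w2) = 0"
    if "(w1, w2) \<in> Poly_Mapping.keys (coproduct v)" for w1 w2
  proof -
    have "length (letters w2) + 1 \<le> q"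
      using keys_coproduct[OF that] less.prems(2) by fastforce
    then show ?thesis
      using less.prems(1,3) by (intro less.IH[where p = p and q = "q - 1"])
        (auto simp: of_word_def split: if_splits)
  qed
  have "sweedler (\<lambda>u1 u2. u1 * var_a * mixing_rsn 2 s (n - 1) u2 v) (coproduct u) = 0"
    unfolding sweedler_def by (intro sum.neutral) (auto simp del: One_nat_def simp: 1)
  moreover have "sweedler (\<lambda>v1 v2. v1 * var_b * mixing_rsn 1 s (n - 1) u v2) (coproduct v) = 0"
    unfolding sweedler_def by (intro sum.neutral) (auto simp del: One_nat_def simp: 2)
  ultimately show ?case by (subst mixing_rsn.simps) (simp only: n if_False if_cancel)
qed

lemma finite_mixing_support: "finite (mixing_support r s u v)"
proof -
  define m where "m x = (\<Sum>w\<in>Poly_Mapping.keys x. length (letters w))" for x :: alg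
  have m: "length (letters w) \<le> m x" if "w \<in> Poly_Mapping.keys x" for w x
    unfolding m_def using that by (intro member_le_sum) auto
  have "mixing_support r s u v \<subseteq> {..m u + m v + 2}"
  proof
    fix n assume "n \<in> mixing_support r s u v"
    then have "mixing_rsn r s n u v \<noteq> 0" by (simp add: mixing_support_def)
    then have "\<not> n > m u + m v + 2" using mixing_rsn_eq_0[OF m m] by metis
    then show "n \<in> {..m u + m v + 2}" by simp
  qed
  then show ?thesis by (rule finite_subset) simp
qed

section \<open>Weighted Delannoy paths\<close>

datatype delannoy_step = East | North | Northeast

fun displacement :: "delannoy_step \<Rightarrow> int \<times> int" where
  "displacement East = (1, 0)"
| "displacement North = (0, 1)"
| "displacement Northeast = (1, 1)"

text \<open>A path with a given starting point is represented by its list of steps.\<close>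

definition delannoy_paths :: "int \<times> int \<Rightarrow> int \<times> int \<Rightarrow> delannoy_step list set" where
  "delannoy_paths P Q = {steps. P + sum_list (map displacement steps) = Q}"

fun step_weight :: "delannoy_step \<Rightarrow> alg" where
  "step_weight East = elt_c"
| "step_weight North = elt_c"
| "step_weight Northeast = 2 * elt_d - elt_c ^ 2"

definition path_weight :: "delannoy_step list \<Rightarrow> alg" where
  "path_weight steps = prod_list (map step_weight steps)"

lemma finite_delannoy_paths: "finite (delannoy_paths P Q)"
proof -
  have *: "int (length steps) \<le> fst (sum_list (map displacement steps)) + snd (sum_list (map displacement steps))"
    for steps
  proof (induction steps)
    case (Cons s steps)
    then show ?case by (cases s) auto
  qed simp
  have "delannoy_paths P Q \<subseteq>
          {steps. set steps \<subseteq> {East, North, Northeast} \<and>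
             length steps \<le> nat (fst Q + snd Q - fst P - snd P)}"
  proof
    fix steps assume "steps \<in> delannoy_paths P Q"
    then have "Q = P + sum_list (map displacement steps)" by (simp add: delannoy_paths_def)
    then have "int (length steps) \<le> fst Q + snd Q - fst P - snd P"
      using *[of steps] by simp
    moreover have "set steps \<subseteq> {East, North, Northeast}"
    proof
      fix s show "s \<in> {East, North, Northeast}" by (cases s) simp_all
    qed
    ultimately show "steps \<in> {steps. set steps \<subseteq> {East, North, Northeast} \<and>
             length steps \<le> nat (fst Q + snd Q - fst P - snd P)}" by auto
  qed
  then show ?thesis by (rule finite_subset) (simp add: finite_lists_length_le)
qed

end

theory Submission
  imports Defs
begin

text \<open>
  Let \<open>f i j\<close> and \<open>g i j\<close> be the parts of \<open>M(c\<^sup>i, c\<^sup>j)\<close> with \<open>r = 1\<close> and \<open>r = 2\<close>. The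
  coproduct is a derivation with \<open>\<Delta>(c) = 2 (1 \<otimes> 1)\<close>, which turns the Sweedler sums into
  \<open>f (i+1) j = c f i j + 2 a g i j\<close> and \<open>g i (j+1) = c g i j + 2 b f i j\<close>. Since
  \<open>2 a - c = a - b = - (2 b - c)\<close> and \<open>- (a - b)\<^sup>2 = 2 d - c\<^sup>2\<close>, the sum \<open>f + g\<close> satisfies the
  recursion that the path weights satisfy by removing the first step.
\<close>

section \<open>Linear maps on the free algebra\<close>

text \<open>A rational \<open>q\<close> acts on \<open>alg\<close> as left multiplication by the
  constant \<open>of_scalar q\<close>, so this is linearity over the rationals.\<close>

definition scalar_linear :: "(alg \<Rightarrow> alg) \<Rightarrow> bool" where
  "scalar_linear h \<longleftrightarrow>
     (\<forall>x y. h (x + y) = h x + h y) \<and> (\<forall>q x. h (of_scalar q * x) = of_scalar q * h x)"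

lemma scalar_linearI:
  assumes "\<And>x y. h (x + y) = h x + h y" "\<And>q x. h (of_scalar q * x) = of_scalar q * h x"
  shows "scalar_linear h"
  using assms by (simp add: scalar_linear_def)

lemma scalar_linear_add: "scalar_linear h \<Longrightarrow> h (x + y) = h x + h y"
  and scalar_linear_scale: "scalar_linear h \<Longrightarrow> h (of_scalar q * x) = of_scalar q * h x"
  by (simp_all add: scalar_linear_def)

lemma of_scalar_simps [simp]:
  "of_scalar 0 = 0" "of_scalar 1 = 1" "of_scalar p + of_scalar q = of_scalar (p + q)"
  "of_scalar p * of_scalar q = of_scalar (p * q)"
  by (simp_all add: of_scalar_def single_add mult_single)

lemma scalar_linear_0: "scalar_linear h \<Longrightarrow> h 0 = 0"
  using scalar_linear_scale[of h 0 0] by simp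

lemma alg_eq_sum_words: "x = (\<Sum>w\<in>Poly_Mapping.keys x. of_scalar (Poly_Mapping.lookup x w) * of_word w)"
  (is "x = ?s")
proof (rule poly_mapping_eqI)
  fix k
  have "Poly_Mapping.lookup ?s k = (\<Sum>w\<in>Poly_Mapping.keys x. if w = k then Poly_Mapping.lookup x k else 0)"
    unfolding Poly_Mapping.lookup_sum lookup_of_scalar_times
    by (intro sum.cong) (auto simp: of_word_def lookup_single)
  also have "\<dots> = Poly_Mapping.lookup x k"
    by (simp add: sum.delta in_keys_iff)
  finally show "Poly_Mapping.lookup x k = Poly_Mapping.lookup ?s k" ..
qed

text \<open>The words span the algebra: every element is a finite sum of scaled words.\<close>

lemma alg_induct [case_names zero word add]:
  assumes "P 0" and "\<And>q w. P (of_scalar q * of_word w)" and "\<And>x y. P x \<Longrightarrow> P y \<Longrightarrow> P (x + y)"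
  shows "P x"
proof -
  have "P (\<Sum>w\<in>S. of_scalar (Poly_Mapping.lookup x w) * of_word w)" for S
    by (induction S rule: infinite_finite_induct) (auto intro: assms)
  then show ?thesis using alg_eq_sum_words[of x] by metis
qed

text \<open>A scalar sits at the empty word, so multiplying a word by it on either side only changes
  the coefficient. This makes left multiplication by a fixed element linear.\<close>

lemma of_scalar_commute: "x * of_scalar q = of_scalar q * x"
  by (induction x rule: alg_induct)
    (auto simp: of_scalar_def of_word_def mult_single mult.commute algebra_simps)

lemma scalar_linear_eqI:
  assumes "scalar_linear g" "scalar_linear h" "\<And>w. g (of_word w) = h (of_word w)"
  shows "g x = h x"
  using assms
  by (induction x rule: alg_induct)
    (auto simp: scalar_linear_0 scalar_linear_add scalar_linear_scale)

lemma scalar_linear_ident: "scalar_linear (\<lambda>x. x)"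
  by (simp add: scalar_linear_def)

lemma scalar_linear_plus:
  "scalar_linear g \<Longrightarrow> scalar_linear h \<Longrightarrow> scalar_linear (\<lambda>x. g x + h x)"
  by (simp add: scalar_linear_def algebra_simps)

lemma scalar_linear_mult_left: "scalar_linear h \<Longrightarrow> scalar_linear (\<lambda>x. y * h x)"
  unfolding scalar_linear_def by (simp add: distrib_left) (metis mult.assoc of_scalar_commute)

lemma scalar_linear_mult_right: "scalar_linear h \<Longrightarrow> scalar_linear (\<lambda>x. h x * y)"
  by (simp add: scalar_linear_def distrib_right mult.assoc)

lemma scalar_linear_zero: "scalar_linear (\<lambda>x. 0)"
  by (simp add: scalar_linear_def)

lemma scalar_linear_if:
  "scalar_linear g \<Longrightarrow> scalar_linear h \<Longrightarrow> scalar_linear (\<lambda>x. if P then g x else h x)"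
  by (cases P) simp_all

lemma scalar_linear_compose:
  "scalar_linear g \<Longrightarrow> scalar_linear h \<Longrightarrow> scalar_linear (\<lambda>x. g (h x))"
  by (simp add: scalar_linear_def)

lemma scalar_linear_sum:
  "(\<And>i. i \<in> I \<Longrightarrow> scalar_linear (h i)) \<Longrightarrow> scalar_linear (\<lambda>x. \<Sum>i\<in>I. h i x)"
  by (simp add: scalar_linear_def sum.distrib sum_distrib_left)

lemmas scalar_linear_intros =
  scalar_linear_zero scalar_linear_ident scalar_linear_if scalar_linear_plus scalar_linear_mult_left scalar_linear_mult_right

section \<open>Sweedler sums\<close>

text \<open>Allowing any finite \<open>K\<close> that contains the support lets \<open>x\<close>,
  \<open>y\<close> and \<open>x + y\<close> be expanded over one index set when additivity is
  shown.\<close>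

lemma lookup_coproduct:
  assumes "finite K" "Poly_Mapping.keys u \<subseteq> K"
  shows "Poly_Mapping.lookup (coproduct u) k =
           (\<Sum>w\<in>K. Poly_Mapping.lookup u w * Poly_Mapping.lookup (coproduct_word w) k)"
proof -
  have "Poly_Mapping.lookup (coproduct u) k =
      (\<Sum>w\<in>Poly_Mapping.keys u. Poly_Mapping.lookup u w * Poly_Mapping.lookup (coproduct_word w) k)"
    by (auto simp: coproduct_def Poly_Mapping.lookup_sum map.rep_eq when_def intro!: sum.cong)
  also have "\<dots> = (\<Sum>w\<in>K. Poly_Mapping.lookup u w * Poly_Mapping.lookup (coproduct_word w) k)"
    using assms by (intro sum.mono_neutral_left) (auto simp: in_keys_iff)
  finally show ?thesis .
qed

lemma sweedler_superset:
  assumes "finite K" "Poly_Mapping.keys t \<subseteq> K"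
  shows "sweedler f t =
           (\<Sum>k\<in>K. of_scalar (Poly_Mapping.lookup t k) * f (of_word (fst k)) (of_word (snd k)))"
  unfolding sweedler_def using assms
  by (intro sum.mono_neutral_cong_left) (auto simp: in_keys_iff)

text \<open>\<open>f\<close> is evaluated only at pairs of basis words, so the value depends
  linearly on the coefficients of the tensor.\<close>

lemma sweedler_add_arg: "sweedler f (s + t) = sweedler f s + sweedler f t"
proof -
  let ?K = "Poly_Mapping.keys s \<union> Poly_Mapping.keys t"
  have "sweedler f x = (\<Sum>k\<in>?K. of_scalar (Poly_Mapping.lookup x k) * f (of_word (fst k)) (of_word (snd k)))"
    if "x \<in> {s, t, s + t}" for x
    using that Poly_Mapping.keys_add[of s t] by (intro sweedler_superset) auto
  then show ?thesis
    by (simp add: lookup_add sum.distrib distrib_right flip: of_scalar_simps(3))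
qed

lemma sweedler_sum_arg: "sweedler f (\<Sum>i\<in>I. t i) = (\<Sum>i\<in>I. sweedler f (t i))"
proof -
  have "sweedler f 0 = 0" by (simp add: sweedler_def)
  then show ?thesis
    by (induction I rule: infinite_finite_induct) (auto simp: sweedler_add_arg)
qed

lemma sweedler_single:
  "sweedler f (Poly_Mapping.single (w, w') 1) = f (of_word w) (of_word w')"
  by (simp add: sweedler_def)

lemma sweedler_coproduct_word:
  "sweedler f (coproduct (of_word w)) =
     (\<Sum>i<length (letters w).
        f (of_word (Word (take i (letters w)))) (of_word (Word (drop (Suc i) (letters w)))))"
proof -
  have "coproduct (of_word w) = coproduct_word w"
    by (rule poly_mapping_eqI) (simp add: lookup_coproduct[of "{w}"] of_word_def)
  then show ?thesis
    by (simp add: coproduct_word_def sweedler_sum_arg sweedler_single)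
qed

lemma of_word_Nil: "of_word (Word []) = 1"
  by (simp add: of_word_def flip: zero_word_def)

lemma sweedler_coproduct_1: "sweedler f (coproduct 1) = 0"
  using sweedler_coproduct_word[of f "Word []"] by (simp add: of_word_Nil)

lemma scalar_linear_sweedler_coproduct: "scalar_linear (\<lambda>u. sweedler f (coproduct u))"
proof (rule scalar_linearI)
  fix x y :: alg
  let ?K = "Poly_Mapping.keys x \<union> Poly_Mapping.keys y"
  have *: "Poly_Mapping.lookup (coproduct z) k =
      (\<Sum>w\<in>?K. Poly_Mapping.lookup z w * Poly_Mapping.lookup (coproduct_word w) k)"
    if "z \<in> {x, y, x + y}" for z k
    using that Poly_Mapping.keys_add[of x y] by (intro lookup_coproduct) auto
  have "coproduct (x + y) = coproduct x + coproduct y"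
    by (rule poly_mapping_eqI) (simp add: * lookup_add sum.distrib distrib_right)
  then show "sweedler f (coproduct (x + y)) = sweedler f (coproduct x) + sweedler f (coproduct y)"
    by (simp add: sweedler_add_arg)
next
  fix q and x :: alg
  have "Poly_Mapping.keys (of_scalar q * x) \<subseteq> Poly_Mapping.keys x"
    by (auto simp: in_keys_iff lookup_of_scalar_times)
  then have *: "Poly_Mapping.lookup (coproduct (of_scalar q * x)) k = q * Poly_Mapping.lookup (coproduct x) k"
    for k
    by (simp add: lookup_coproduct[of "Poly_Mapping.keys x"] lookup_of_scalar_times
        sum_distrib_left mult.assoc)
  then have "Poly_Mapping.keys (coproduct (of_scalar q * x)) \<subseteq> Poly_Mapping.keys (coproduct x)"
    by (auto simp: in_keys_iff)
  then show "sweedler f (coproduct (of_scalar q * x)) = of_scalar q * sweedler f (coproduct x)"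
    by (simp add: sweedler_superset[of "Poly_Mapping.keys (coproduct x)"] * sum_distrib_left
        flip: of_scalar_simps(4) mult.assoc)
qed

lemma scalar_linear_sweedler_fun:
  assumes "\<And>u1 u2. scalar_linear (\<lambda>v. f v u1 u2)"
  shows "scalar_linear (\<lambda>v. sweedler (f v) t)"
  unfolding sweedler_def case_prod_unfold
  by (intro scalar_linear_sum scalar_linear_mult_left assms)

text \<open>This is the derivation rule for a leading letter: deleting \<open>x\<close> itself
  leaves the tensor of \<open>1\<close> and \<open>u\<close>, and deleting a later letter keeps
  \<open>x\<close> in front of the left factor. Both sides are linear in \<open>u\<close>, so words
  suffice. In the applications \<open>y\<close> is the inserted letter and \<open>g\<close> the
  inner mixing operator.\<close>

lemma sweedler_coproduct_letter_times:
  assumes "scalar_linear g"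
  shows "sweedler (\<lambda>u1 u2. u1 * y * g u2) (coproduct (of_word (Word [x]) * u)) =
           y * g u + of_word (Word [x]) * sweedler (\<lambda>u1 u2. u1 * y * g u2) (coproduct u)"
proof (rule scalar_linear_eqI[of "\<lambda>u. sweedler _ (coproduct (of_word (Word [x]) * u))"])
  show "scalar_linear (\<lambda>u. sweedler (\<lambda>u1 u2. u1 * y * g u2) (coproduct (of_word (Word [x]) * u)))"
    by (rule scalar_linear_compose[OF scalar_linear_sweedler_coproduct])
      (intro scalar_linear_intros)
  show "scalar_linear (\<lambda>u. y * g u
      + of_word (Word [x]) * sweedler (\<lambda>u1 u2. u1 * y * g u2) (coproduct u))"
    by (intro scalar_linear_intros assms scalar_linear_sweedler_coproduct)
  fix w :: word
  have cons: "of_word (Word (x # l)) = of_word (Word [x]) * of_word (Word l)" for l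
    by (simp add: of_word_times plus_word_def)
  obtain l where w: "w = Word l" by (cases w)
  \<comment> \<open>The summand for position 0 is split off; in all others the deleted letter lies
    in \<open>l\<close>.\<close>
  have "sweedler (\<lambda>u1 u2. u1 * y * g u2) (coproduct (of_word (Word (x # l)))) =
      of_word (Word []) * y * g (of_word (Word l))
      + (\<Sum>i<length l. of_word (Word (x # take i l)) * y * g (of_word (Word (drop (Suc i) l))))"
    by (simp add: sweedler_coproduct_word sum.lessThan_Suc_shift del: sum.lessThan_Suc)
  also have "of_word (Word []) = 1"
    by (rule of_word_Nil)
  also have "(\<Sum>i<length l. of_word (Word (x # take i l)) * y * g (of_word (Word (drop (Suc i) l)))) =
      of_word (Word [x]) * sweedler (\<lambda>u1 u2. u1 * y * g u2) (coproduct (of_word w))"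
    by (simp add: cons[of "take _ _"] w sweedler_coproduct_word sum_distrib_left mult.assoc)
  finally show "sweedler (\<lambda>u1 u2. u1 * y * g u2) (coproduct (of_word (Word [x]) * of_word w)) =
      y * g (of_word w)
      + of_word (Word [x]) * sweedler (\<lambda>u1 u2. u1 * y * g u2) (coproduct (of_word w))"
    by (simp add: w flip: cons)
qed

text \<open>Each of the two letters in \<open>c\<close> contributes \<open>y * g u\<close> when it
  is the one deleted, hence the factor 2.\<close>

lemma sweedler_coproduct_c_times:
  assumes "scalar_linear g"
  shows "sweedler (\<lambda>u1 u2. u1 * y * g u2) (coproduct (elt_c * u)) =
           2 * (y * g u) + elt_c * sweedler (\<lambda>u1 u2. u1 * y * g u2) (coproduct u)"
  using sweedler_coproduct_letter_times[OF assms]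
  by (simp add: elt_c_def var_a_def var_b_def distrib_right mult_2 add_ac
      scalar_linear_add[OF scalar_linear_sweedler_coproduct])

section \<open>The mixing operators on powers of \<open>c\<close>\<close>

lemma mixing_rsn_2:
  "mixing_rsn r s 2 u v =
     (if r = 1 \<and> s = 2 then u * var_a * v else if r = 2 \<and> s = 1 then v * var_b * u else 0)"
  by (subst mixing_rsn.simps) simp

lemma mixing_rsn_junk: "n < 2 \<or> (n > 2 \<and> r \<notin> {1, 2}) \<Longrightarrow> mixing_rsn r s n u v = 0"
  by (subst mixing_rsn.simps) auto

text \<open>The cases follow the recursion: values that are 0 by default, the explicit values at
  \<open>n = 2\<close>, and one recursive rule for each \<open>r\<close>.\<close>

lemma mixing_rsn_cases [case_names junk base one two]:
  fixes n r :: nat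
  assumes "n < 2 \<or> (n > 2 \<and> r \<notin> {1, 2}) \<Longrightarrow> P" "n = 2 \<Longrightarrow> P"
    "\<And>m. n = m + 1 \<Longrightarrow> m \<ge> 2 \<Longrightarrow> r = 1 \<Longrightarrow> P" "\<And>m. n = m + 1 \<Longrightarrow> m \<ge> 2 \<Longrightarrow> r = 2 \<Longrightarrow> P"
  shows P
proof -
  consider "n < 2 \<or> (n > 2 \<and> r \<notin> {1, 2})" | "n = 2"
    | "n > 2" "r = 1" | "n > 2" "r = 2"
    by auto linarith
  then show ?thesis using assms(1,2) assms(3,4)[of "n - 1"] by cases simp_all
qed

text \<open>In the argument that is split, linearity comes from the coproduct. In the other argument
  it is inherited from the inner operator, which has the opposite \<open>r\<close>, so the induction
  on \<open>n\<close> keeps \<open>r\<close> arbitrary.\<close>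

lemma scalar_linear_mixing_rsn:
  "scalar_linear (\<lambda>u. mixing_rsn r s n u v)" "scalar_linear (\<lambda>v. mixing_rsn r s n u v)"
proof (induction n arbitrary: r u v rule: less_induct)
  case (less n)
  {
    case 1
    show ?case
    proof (cases n r rule: mixing_rsn_cases)
      case (one m)
      show ?thesis
        unfolding one(1,3) mixing_rsn_step[OF one(2)] by (rule scalar_linear_sweedler_coproduct)
    next
      case (two m)
      show ?thesis
        unfolding two(1,3) mixing_rsn_step[OF two(2)]
        by (intro scalar_linear_sweedler_fun scalar_linear_intros less) (simp add: two)
    qed (auto simp: mixing_rsn_junk mixing_rsn_2 simp del: One_nat_def intro!: scalar_linear_intros)
  next
    case 2
    show ?case
    proof (cases n r rule: mixing_rsn_cases)
      case (one m)
      show ?thesis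
        unfolding one(1,3) mixing_rsn_step[OF one(2)]
        by (intro scalar_linear_sweedler_fun scalar_linear_intros less) (simp add: one)
    next
      case (two m)
      show ?thesis
        unfolding two(1,3) mixing_rsn_step[OF two(2)] by (rule scalar_linear_sweedler_coproduct)
    qed (auto simp: mixing_rsn_junk mixing_rsn_2 simp del: One_nat_def intro!: scalar_linear_intros)
  }
qed

lemma mixing_rsn_1_c_times:
  "n \<ge> 2 \<Longrightarrow> mixing_rsn 1 s (Suc n) (elt_c * u) v =
     2 * (var_a * mixing_rsn 2 s n u v) + elt_c * mixing_rsn 1 s (Suc n) u v"
  using mixing_rsn_step(1)[of n s] sweedler_coproduct_c_times[OF scalar_linear_mixing_rsn(1)]
  by simp

lemma mixing_rsn_2_c_times:
  "n \<ge> 2 \<Longrightarrow> mixing_rsn 2 s (Suc n) u (elt_c * v) =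
     2 * (var_b * mixing_rsn 1 s n u v) + elt_c * mixing_rsn 2 s (Suc n) u v"
  using mixing_rsn_step(2)[of n s] sweedler_coproduct_c_times[OF scalar_linear_mixing_rsn(2)]
  by simp

lemma mixing_rsn_eq_0_if_odd:
  assumes "odd (int n - int r - int s - 1)" "r \<in> {1, 2}" "s \<in> {1, 2}"
  shows "mixing_rsn r s n u v = 0"
  using assms
proof (induction n arbitrary: r u v rule: less_induct)
  case (less n)
  show ?case
  proof (cases n r rule: mixing_rsn_cases)
    case (one m)
    have "mixing_rsn 2 s m u' v' = 0" for u' v'
      using less.prems by (intro less.IH) (auto simp: one)
    then show ?thesis
      unfolding one(1,3) mixing_rsn_step[OF one(2)] by (simp add: sweedler_def)
  next
    case (two m)
    have "mixing_rsn 1 s m u' v' = 0" for u' v'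
      using less.prems by (intro less.IH) (auto simp: two)
    then show ?thesis
      unfolding two(1,3) mixing_rsn_step[OF two(2)] by (simp add: sweedler_def)
  next
    case junk
    then show ?thesis by (rule mixing_rsn_junk)
  next
    case base
    with less.prems have "r = s" by auto
    with base show ?thesis by (auto simp: mixing_rsn_2)
  qed
qed

section \<open>Reduction of \<open>M\<close> on powers of \<open>c\<close> to sums over an
  interval\<close>

lemma length_keys_c_power:
  "w \<in> Poly_Mapping.keys (elt_c ^ i) \<Longrightarrow> length (letters w) \<le> i"
proof (induction i arbitrary: w)
  case 0
  then show ?case by (auto simp: zero_word_def split: if_splits)
next
  case (Suc i)
  then have "w \<in> {x + y | x y. x \<in> Poly_Mapping.keys elt_c \<and> y \<in> Poly_Mapping.keys (elt_c ^ i)}"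
    using keys_mult[of elt_c "elt_c ^ i"] by auto
  then obtain x y where w: "w = x + y" "x \<in> Poly_Mapping.keys elt_c" "y \<in> Poly_Mapping.keys (elt_c ^ i)"
    by blast
  then have "x \<in> {Word [A], Word [B]}"
    using Poly_Mapping.keys_add[of var_a var_b]
    by (auto simp: elt_c_def var_a_def var_b_def of_word_def)
  then show ?case using Suc.IH[OF w(3)] w(1) by (auto simp: plus_word_def)
qed

lemma mixing_rsn_c_power_eq_0:
  "n \<ge> i + j + 3 \<Longrightarrow> mixing_rsn r s n (elt_c ^ i) (elt_c ^ j) = 0"
  by (rule mixing_rsn_eq_0[of _ i _ j]) (auto simp: length_keys_c_power)

text \<open>The \<open>f\<close> and \<open>g\<close> of the overview are the values at
  \<open>r = 1\<close> and \<open>r = 2\<close>. A plain interval suffices because operators of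
  wrong parity, and those with \<open>n \<ge> i + j + 3\<close>, vanish on these powers.\<close>

definition mixing_part :: "nat \<Rightarrow> nat \<Rightarrow> nat \<Rightarrow> alg" where
  "mixing_part r i j =
     (\<Sum>s\<in>{1,2}. \<Sum>n\<in>{2..<i + j + 3}. mixing_rsn r s n (elt_c ^ i) (elt_c ^ j))"

text \<open>The added summands vanish. The recursions below compare sums for different exponents,
  which thereby get matching ranges.\<close>

lemma mixing_part_bound:
  assumes "N \<ge> i + j + 3"
  shows "mixing_part r i j = (\<Sum>s\<in>{1,2}. \<Sum>n\<in>{2..<N}. mixing_rsn r s n (elt_c ^ i) (elt_c ^ j))"
  unfolding mixing_part_def using assms
  by (intro sum.cong sum.mono_neutral_left) (auto simp: mixing_rsn_c_power_eq_0)

lemma mixing_c_power: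
  "mixing (elt_c ^ i) (elt_c ^ j) = mixing_part 1 i j + mixing_part 2 i j"
proof -
  have "(\<Sum>n\<in>mixing_support r s (elt_c ^ i) (elt_c ^ j). mixing_rsn r s n (elt_c ^ i) (elt_c ^ j)) =
      (\<Sum>n\<in>{2..<i + j + 3}. mixing_rsn r s n (elt_c ^ i) (elt_c ^ j))"
    if "r \<in> {1, 2}" "s \<in> {1, 2}" for r s
  proof (rule sum.mono_neutral_left)
    show "mixing_support r s (elt_c ^ i) (elt_c ^ j) \<subseteq> {2..<i + j + 3}"
    proof
      fix n assume "n \<in> mixing_support r s (elt_c ^ i) (elt_c ^ j)"
      then have n: "n \<ge> 2" and "mixing_rsn r s n (elt_c ^ i) (elt_c ^ j) \<noteq> 0"
        by (simp_all add: mixing_support_def)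
      then have "\<not> n \<ge> i + j + 3"
        using mixing_rsn_c_power_eq_0 by blast
      with n show "n \<in> {2..<i + j + 3}" by simp
    qed
    show "\<forall>n\<in>{2..<i + j + 3} - mixing_support r s (elt_c ^ i) (elt_c ^ j).
        mixing_rsn r s n (elt_c ^ i) (elt_c ^ j) = 0"
    proof
      fix n assume "n \<in> {2..<i + j + 3} - mixing_support r s (elt_c ^ i) (elt_c ^ j)"
      \<comment> \<open>An index of the interval is missing from the support because the operator
        vanishes or because the parity is wrong, and wrong parity forces vanishing too.\<close>
      then have "mixing_rsn r s n (elt_c ^ i) (elt_c ^ j) = 0 \<or> odd (int n - int r - int s - 1)"
        unfolding mixing_support_def by fastforce
      then show "mixing_rsn r s n (elt_c ^ i) (elt_c ^ j) = 0"
        using mixing_rsn_eq_0_if_odd[OF _ that] by blast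
    qed
  qed simp
  then show ?thesis by (simp add: mixing_def mixing_part_def)
qed

section \<open>Initial values and recursions for the two parts\<close>

lemma sum_from_2_split_first:
  fixes f :: "nat \<Rightarrow> alg"
  shows "(\<Sum>n\<in>{2..<Suc (N + 2)}. f n) = f 2 + (\<Sum>n\<in>{2..<N + 2}. f (Suc n))"
  using sum.atLeast_Suc_lessThan[of 2 "Suc (N + 2)" f] sum.shift_bounds_Suc_ivl[of f 2 "N + 2"]
  by simp

text \<open>Since \<open>coproduct 1 = 0\<close>, only the base operator with \<open>n = 2\<close>
  and \<open>s = 2\<close> survives.\<close>

lemma mixing_part_1_0: "mixing_part 1 0 j = var_a * elt_c ^ j"
proof -
  have z: "mixing_rsn 1 s (Suc n) 1 v = 0" if "n \<ge> 2" for s n v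
    using that mixing_rsn_step(1)[of n s 1 v] by (simp add: sweedler_coproduct_1)
  have N: "0 + j + 3 = Suc (j + 2)" by simp
  show ?thesis
    unfolding mixing_part_def N sum_from_2_split_first power_0
    by (simp add: z[simplified] mixing_rsn_2 del: sum.op_ivl_Suc)
qed

text \<open>Here the base operator with \<open>s = 1\<close> survives; its reversed order
  \<open>v * b * u\<close> puts \<open>v = 1\<close> in front.\<close>

lemma mixing_part_2_0: "mixing_part 2 i 0 = var_b * elt_c ^ i"
proof -
  have z: "mixing_rsn 2 s (Suc n) u 1 = 0" if "n \<ge> 2" for s n u
    using that mixing_rsn_step(2)[of n s u 1] by (simp add: sweedler_coproduct_1)
  have N: "i + 0 + 3 = Suc (i + 2)" by simp
  show ?thesis
    unfolding mixing_part_def N sum_from_2_split_first power_0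
    by (simp add: z mixing_rsn_2 del: sum.op_ivl_Suc)
qed

lemma mixing_part_1_Suc:
  "mixing_part 1 (Suc i) j = elt_c * mixing_part 1 i j + 2 * (var_a * mixing_part 2 i j)"
proof -
  \<comment> \<open>Both \<open>?N + 2\<close> and \<open>Suc (?N + 2)\<close> reach past the
    vanishing bounds they are used for. The range for \<open>mixing_part 2\<close> ends one earlier
    because the recursion lowers \<open>n\<close> by one.\<close>
  let ?N = "Suc (i + j + 1)"
  have *: "(\<Sum>n\<in>{2..<?N + 2}. mixing_rsn 1 s (Suc n) (elt_c ^ Suc i) v) =
      2 * (var_a * (\<Sum>n\<in>{2..<?N + 2}. mixing_rsn 2 s n (elt_c ^ i) v))
      + elt_c * (\<Sum>n\<in>{2..<?N + 2}. mixing_rsn 1 s (Suc n) (elt_c ^ i) v)" for s v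
    by (simp only: sum_distrib_left flip: sum.distrib)
      (intro sum.cong, auto simp: mixing_rsn_1_c_times[simplified])
  \<comment> \<open>A nonzero base term begins with its first argument, so the new factor
    \<open>c\<close> already stands in front.\<close>
  have b: "mixing_rsn 1 s 2 (elt_c ^ Suc i) v = elt_c * mixing_rsn 1 s 2 (elt_c ^ i) v" for s v
    by (simp add: mixing_rsn_2 mult.assoc)
  have "mixing_part 1 (Suc i) j =
      (\<Sum>s\<in>{1,2}. \<Sum>n\<in>{2..<Suc (?N + 2)}. mixing_rsn 1 s n (elt_c ^ Suc i) (elt_c ^ j))"
    by (rule mixing_part_bound) simp
  moreover have "mixing_part 1 i j =
      (\<Sum>s\<in>{1,2}. \<Sum>n\<in>{2..<Suc (?N + 2)}. mixing_rsn 1 s n (elt_c ^ i) (elt_c ^ j))"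
    by (rule mixing_part_bound) simp
  moreover have "mixing_part 2 i j =
      (\<Sum>s\<in>{1,2}. \<Sum>n\<in>{2..<?N + 2}. mixing_rsn 2 s n (elt_c ^ i) (elt_c ^ j))"
    by (rule mixing_part_bound) simp
  ultimately show ?thesis
    by (simp only: sum_from_2_split_first * b) (simp add: distrib_left add_ac)
qed

lemma mixing_part_2_Suc:
  "mixing_part 2 i (Suc j) = elt_c * mixing_part 2 i j + 2 * (var_b * mixing_part 1 i j)"
proof -
  let ?N = "Suc (i + j + 1)"
  have *: "(\<Sum>n\<in>{2..<?N + 2}. mixing_rsn 2 s (Suc n) u (elt_c ^ Suc j)) =
      2 * (var_b * (\<Sum>n\<in>{2..<?N + 2}. mixing_rsn 1 s n u (elt_c ^ j)))
      + elt_c * (\<Sum>n\<in>{2..<?N + 2}. mixing_rsn 2 s (Suc n) u (elt_c ^ j))" for s u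
    by (simp only: sum_distrib_left flip: sum.distrib)
      (intro sum.cong, auto simp: mixing_rsn_2_c_times[simplified])
  \<comment> \<open>Now the base term begins with its second argument.\<close>
  have b: "mixing_rsn 2 s 2 u (elt_c ^ Suc j) = elt_c * mixing_rsn 2 s 2 u (elt_c ^ j)" for s u
    by (simp add: mixing_rsn_2 mult.assoc)
  have "mixing_part 2 i (Suc j) =
      (\<Sum>s\<in>{1,2}. \<Sum>n\<in>{2..<Suc (?N + 2)}. mixing_rsn 2 s n (elt_c ^ i) (elt_c ^ Suc j))"
    by (rule mixing_part_bound) simp
  moreover have "mixing_part 2 i j =
      (\<Sum>s\<in>{1,2}. \<Sum>n\<in>{2..<Suc (?N + 2)}. mixing_rsn 2 s n (elt_c ^ i) (elt_c ^ j))"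
    by (rule mixing_part_bound) simp
  moreover have "mixing_part 1 i j =
      (\<Sum>s\<in>{1,2}. \<Sum>n\<in>{2..<?N + 2}. mixing_rsn 1 s n (elt_c ^ i) (elt_c ^ j))"
    by (rule mixing_part_bound) simp
  ultimately show ?thesis
    by (simp only: sum_from_2_split_first * b) (simp add: distrib_left add_ac)
qed

section \<open>Path weights\<close>

text \<open>Integer coordinates let the recursion step outside the quadrant, where the total is
  0.\<close>

definition total_weight :: "int \<Rightarrow> int \<Rightarrow> alg" where
  "total_weight p q = (\<Sum>steps\<in>delannoy_paths 0 (p, q). path_weight steps)"

lemma delannoy_paths_translate: "delannoy_paths P Q = delannoy_paths 0 (Q - P)"
  by (auto simp: delannoy_paths_def algebra_simps)

lemma total_weight_negative:
  assumes "p < 0 \<or> q < 0"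
  shows "total_weight p q = 0"
proof -
  have nonneg: "fst (sum_list (map displacement steps)) \<ge> 0 \<and> snd (sum_list (map displacement steps)) \<ge> 0"
    for steps
  proof (induction steps)
    case (Cons s steps)
    then show ?case by (cases s) auto
  qed simp
  have "delannoy_paths 0 (p, q) = {}"
  proof (rule equals0I)
    fix steps assume "steps \<in> delannoy_paths 0 (p, q)"
    then have "sum_list (map displacement steps) = (p, q)"
      by (simp add: delannoy_paths_def)
    with nonneg[of steps] assms show False by auto
  qed
  then show ?thesis by (simp add: total_weight_def)
qed

text \<open>Weights are multiplied in path order, so the first step contributes a left factor. The
  constant 1 is the weight of the empty path.\<close>

lemma total_weight_rec:
  "total_weight p q = (if p = 0 \<and> q = 0 then 1 else 0)
     + elt_c * total_weight (p - 1) q + elt_c * total_weight p (q - 1)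
     + (2 * elt_d - elt_c ^ 2) * total_weight (p - 1) (q - 1)"
proof -
  let ?C = "\<lambda>s. (#) s ` delannoy_paths 0 ((p, q) - displacement s)"
  have eq: "delannoy_paths 0 (p, q) =
      (if p = 0 \<and> q = 0 then {[]} else {}) \<union> ?C East \<union> ?C North \<union> ?C Northeast"
    (is "?L = ?R")
  proof (rule set_eqI)
    fix l
    show "l \<in> ?L \<longleftrightarrow> l \<in> ?R"
    proof (cases l)
      case (Cons s l')
      then show ?thesis
        by (cases s; cases "sum_list (map displacement l')") (auto simp: delannoy_paths_def image_iff zero_prod_def)
    qed (auto simp: delannoy_paths_def zero_prod_def)
  qed
  have w: "sum path_weight (?C s) = step_weight s * (\<Sum>steps\<in>delannoy_paths 0 ((p, q) - displacement s). path_weight steps)"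
    for s
    by (simp add: sum.reindex sum_distrib_left path_weight_def)
  have fin: "finite (?C s)" for s
    by (simp add: finite_delannoy_paths)
  \<comment> \<open>\<open>E\<close> covers both cases for the empty path; the other three sets
    differ in the first step.\<close>
  have "sum path_weight (E \<union> ?C East \<union> ?C North \<union> ?C Northeast) =
      sum path_weight E + sum path_weight (?C East) + sum path_weight (?C North)
      + sum path_weight (?C Northeast)" if "finite E" "E \<subseteq> {[]}" for E
  proof -
    have "E \<inter> ?C East = {}" "(E \<union> ?C East) \<inter> ?C North = {}"
      "(E \<union> ?C East \<union> ?C North) \<inter> ?C Northeast = {}"
      using that by auto
    then show ?thesis
      by (simp only: sum.union_disjoint finite_Un fin that)
  qed
  note this[of "if p = 0 \<and> q = 0 then {[]} else {}", folded eq]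
  then show ?thesis
    unfolding w by (simp add: total_weight_def path_weight_def)
qed

text \<open>On an axis, two of the three shifted points in the recursion have a negative coordinate
  and contribute 0.\<close>

lemma total_weight_axis:
  "total_weight (int i) 0 = elt_c ^ i" "total_weight 0 (int i) = elt_c ^ i"
proof (induction i)
  case 0
  { case 1 show ?case by (subst total_weight_rec) (simp add: total_weight_negative)
  next case 2 show ?case by (subst total_weight_rec) (simp add: total_weight_negative) }
next
  case (Suc i)
  { case 1 show ?case using Suc by (subst total_weight_rec) (simp add: total_weight_negative)
  next case 2 show ?case using Suc by (subst total_weight_rec) (simp add: total_weight_negative) }
qed

section \<open>Both starting points combined, and comparison with the mixing operator\<close>

definition delannoy_total :: "nat \<Rightarrow> nat \<Rightarrow> alg" where
  "delannoy_total i j = total_weight (int i + 1) (int j) + total_weight (int i) (int j + 1)"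

lemma delannoy_total_0_0: "delannoy_total 0 0 = 2 * elt_c"
  using total_weight_axis[of 1] by (simp add: delannoy_total_def mult_2)

text \<open>The part \<open>- c^2\<close> of the Northeast weight cancels one of the two copies of
  \<open>c^(i+2)\<close> that come from the axis.\<close>

lemma delannoy_total_Suc_0:
  "delannoy_total (Suc i) 0 = elt_c * delannoy_total i 0 + 2 * (elt_d * elt_c ^ i)"
  using total_weight_axis(1)[of "Suc i"] total_weight_axis(1)[of "Suc (Suc i)"]
    total_weight_axis(1)[of i] total_weight_rec[of "1 + int i" 1]
  by (simp add: delannoy_total_def algebra_simps power2_eq_square)

lemma delannoy_total_0_Suc:
  "delannoy_total 0 (Suc j) = elt_c * delannoy_total 0 j + 2 * (elt_d * elt_c ^ j)"
  using total_weight_axis(2)[of "Suc j"] total_weight_axis(2)[of "Suc (Suc j)"]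
    total_weight_axis(2)[of j] total_weight_rec[of 1 "1 + int j"]
  by (simp add: delannoy_total_def algebra_simps power2_eq_square)

text \<open>Both target points have positive coordinates, so the empty path does not occur and the
  two recursions simply add up.\<close>

lemma delannoy_total_Suc_Suc:
  "delannoy_total (Suc i) (Suc j) = elt_c * delannoy_total i (Suc j)
     + elt_c * delannoy_total (Suc i) j + (2 * elt_d - elt_c ^ 2) * delannoy_total i j"
  using total_weight_rec[of "2 + int i" "1 + int j"] total_weight_rec[of "1 + int i" "2 + int j"]
  by (simp add: delannoy_total_def algebra_simps)

lemma delannoy_total_eq:
  "delannoy_total i j = 2 * (mixing_part 1 i j + mixing_part 2 i j)"
proof (induction "i + j" arbitrary: i j rule: less_induct)
  case less
  note simps = elt_c_def elt_d_def mult_2 algebra_simps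
  show ?case
  proof (cases i; cases j)
    assume "i = 0" "j = 0"
    then show ?thesis
      by (simp add: delannoy_total_0_0 mixing_part_1_0[simplified] mixing_part_2_0 simps)
  next
    fix i' assume "i = Suc i'" "j = 0"
    then show ?thesis
      \<comment> \<open>The remaining identity is \<open>c b + d = 2 a b + b c\<close>.\<close>
      using less[of i' 0]
      by (simp add: delannoy_total_Suc_0 mixing_part_1_Suc[simplified] mixing_part_2_0 simps)
  next
    fix j' assume "i = 0" "j = Suc j'"
    then show ?thesis
      \<comment> \<open>The remaining identity is \<open>c a + d = 2 b a + a c\<close>.\<close>
      using less[of 0 j']
      by (simp add: delannoy_total_0_Suc mixing_part_2_Suc mixing_part_1_0[simplified] simps)
  next
    fix i' j' assume ij: "i = Suc i'" "j = Suc j'"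
    \<comment> \<open>Only these four values stay opaque; every other part is rewritten in terms of
      them.\<close>
    define f where "f = mixing_part 1 i' j'"
    define g where "g = mixing_part 2 i' j'"
    define f' where "f' = mixing_part 1 i' j"
    define g' where "g' = mixing_part 2 i j'"
    have "delannoy_total i j = elt_c * (2 * (f' + mixing_part 2 i' j))
        + elt_c * (2 * (mixing_part 1 i j' + g')) + (2 * elt_d - elt_c ^ 2) * (2 * (f + g))"
      using less[of i' j] less[of i j'] less[of i' j']
      by (simp add: ij delannoy_total_Suc_Suc f_def g_def f'_def g'_def)
    moreover have "mixing_part 2 i' j = elt_c * g + 2 * (var_b * f)"
      "mixing_part 1 i j' = elt_c * f + 2 * (var_a * g)"
      "mixing_part 1 i j = elt_c * f' + 2 * (var_a * mixing_part 2 i' j)"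
      "mixing_part 2 i j = elt_c * g' + 2 * (var_b * mixing_part 1 i j')"
      by (simp_all only: ij f_def g_def f'_def g'_def mixing_part_1_Suc mixing_part_2_Suc)
    \<comment> \<open>Put \<open>G = mixing_part 2 i' j\<close> and
      \<open>H = mixing_part 1 i j'\<close>. It remains that
      \<open>(2 a - c) G + (2 b - c) H\<close> equals \<open>(2 d - c^2) (f + g)\<close>. The former
      is \<open>(a - b) (G - H)\<close>, and \<open>G - H = - (a - b) (f + g)\<close>.\<close>
    ultimately show ?thesis
      by (simp add: simps power2_eq_square)
  qed
qed

theorem theorem7p4:
  fixes i j :: nat
  shows "mixing (elt_c ^ i) (elt_c ^ j) =
           of_scalar (1 / 2) *
             (\<Sum>P\<in>{(-1, 0), (0, -1)}.
                \<Sum>steps\<in>delannoy_paths P (int i, int j). path_weight steps)"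
proof -
  have half: "of_scalar (1 / 2) * (2 * x) = x" for x
  proof -
    have "of_scalar (1 / 2) * (2 * x) = (of_scalar (1 / 2) + of_scalar (1 / 2)) * x"
      by (simp only: mult_2 distrib_left distrib_right)
    then show ?thesis by simp
  qed
  have "(\<Sum>P\<in>{(-1, 0), (0, -1)}.
      \<Sum>steps\<in>delannoy_paths P (int i, int j). path_weight steps) = delannoy_total i j"
    \<comment> \<open>Moving the starting points to the origin moves the target to
      \<open>(i + 1, j)\<close> and \<open>(i, j + 1)\<close>.\<close>
    using delannoy_paths_translate[of "(-1, 0)" "(int i, int j)"]
      delannoy_paths_translate[of "(0, -1)" "(int i, int j)"]
    by (simp add: delannoy_total_def total_weight_def)
  then show ?thesis
    by (simp only: delannoy_total_eq mixing_c_power half)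
qed

end
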